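(* Let $\pi(x)$ be a real polynomial with $\pi(0)=0$, let $k\in\mathbb{N}$ and let $k_1<k_2$ be arbitrary real numbers. For every $\varepsilon>0$ there exist $\beta\in\mathbb{Q}\setminus\mathbb{Z}$ and $\gamma\in\mathbb{Z}^\ast$ with $dom^+(\beta)=\emptyset=dom^-(\gamma)$ and $\max dom^-(\beta)<k_1<k_2<\min dom^+(\gamma)$, and integers $m(p,q)$ for integers $0\leq p,q\leq k$, such that $|\pi(p\beta+q\gamma)-m(p,q)|<\varepsilon$ for all integers $0\leq p,q\leq k$.
   Context: Notation: $\mathbb{N}=\{1,2,\ldots\}$, $\mathbb{Z}^\ast=\mathbb{Z}\setminus\{0\}$. Expansion of rationals: every rational number $q$ has a unique expression $q=\sum_{s=1}^{\infty}q_{-s}\frac{(-1)^{s}}{(s+1)!}+\sum_{r=1}^{\infty}q_{r}(-1)^{r+1}r!$ with integers $0\leq q_{-s}\leq s$ for $s\geq 1$ and $0\leq q_r\leq r$ for $r\geq 1$, all but finitely many of which are zero. Put $dom(q)=\{t\in\mathbb{Z}^\ast: q_t\neq 0\}$, $dom^-(q)=\{t\in dom(q): t<0\}$, $dom^+(q)=\{t\in dom(q): t>0\}$. *)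

theory Defs
  imports Complex_Main "HOL-Computational_Algebra.Polynomial"
begin

text \<open>
  Digit functions live on the nonzero integers. They are represented as total functions that vanish
  at \<open>0\<close>, so that the expansion of a rational number is unique. As only finitely many digits are
  nonzero, both series are sums over the finite sets of indices with a nonzero digit.
\<close>

definition is_expansion :: "rat \<Rightarrow> (int \<Rightarrow> nat) \<Rightarrow> bool" where
  "is_expansion q d \<longleftrightarrow>
     d 0 = 0 \<and>
     (\<forall>s\<ge>1. d (- int s) \<le> s) \<and>
     (\<forall>r\<ge>1. d (int r) \<le> r) \<and>
     finite {t. d t \<noteq> 0} \<and>
     q = (\<Sum>s | 1 \<le> s \<and> d (- int s) \<noteq> 0. of_nat (d (- int s)) * ((-1) ^ s / fact (s + 1)))
       + (\<Sum>r | 1 \<le> r \<and> d (int r) \<noteq> 0. of_nat (d (int r)) * ((-1) ^ (r + 1) * fact r))"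

definition digits :: "rat \<Rightarrow> int \<Rightarrow> nat" where
  "digits q = (THE d. is_expansion q d)"

definition expansion_dom :: "rat \<Rightarrow> int set" where
  "expansion_dom q = {t. t \<noteq> 0 \<and> digits q t \<noteq> 0}"

definition dom_neg :: "rat \<Rightarrow> int set" where
  "dom_neg q = {t \<in> expansion_dom q. t < 0}"

definition dom_pos :: "rat \<Rightarrow> int set" where
  "dom_pos q = {t \<in> expansion_dom q. t > 0}"

end

(*
  The integer is chosen first. Polynomials without constant term are simultaneously recurrent modulo
  1 along the positive multiples of any integer, so there is a multiple gamma of r! with P(q gamma)
  close to an integer for all q <= k; being divisible by r!, it has no digit below r. With gamma
  fixed, beta = (-1)^s/(s+1)! has a single digit, and for large s continuity of P at the points
  q gamma finishes the proof.

  Recurrence is proved by induction on the degree d: f(x + h) - f(x) - f(h) has degree < d, so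
  recurrence in lower degree yields a sequence T_0 < T_1 < ... with f(T_j - T_i) close to
  s_j - s_i modulo 1 for suitable reals s_j depending on f, and by the pigeonhole principle some
  i < j make s_j - s_i close to 0 modulo 1 for all of the finitely many f at once.
*)
theory Submission
  imports Defs "HOL-Library.FuncSet"
begin

section \<open>Approximation modulo 1 and the pigeonhole principle\<close>

definition near_int :: "real \<Rightarrow> real \<Rightarrow> bool" where
  "near_int e x \<longleftrightarrow> (\<exists>m::int. \<bar>x - of_int m\<bar> < e)"

lemma near_int_mono: "near_int a x \<Longrightarrow> a \<le> b \<Longrightarrow> near_int b x"
  unfolding near_int_def by (blast intro: less_le_trans)

lemma near_int_add:
  assumes "near_int a x" and "near_int b y"
  shows "near_int (a + b) (x + y)"
proof -
  obtain m n :: int where "\<bar>x - of_int m\<bar> < a" "\<bar>y - of_int n\<bar> < b"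
    using assms by (auto simp: near_int_def)
  then have "\<bar>(x + y) - of_int (m + n)\<bar> < a + b"
    by (simp add: abs_if split: if_splits)
  then show ?thesis
    unfolding near_int_def by blast
qed

text \<open>Cutting [0,1) into \<open>K\<close> intervals sorts the tuples of fractional parts into
  finitely many boxes, and among more indices than boxes two share one. The bound \<open>N\<close>
  depends on \<open>F\<close> and \<open>e\<close> alone, so it can be fixed before the sequence is
  constructed.\<close>

lemma simultaneous_pigeonhole:
  assumes "finite F" and "e > 0"
  shows "\<exists>N. \<forall>s :: nat \<Rightarrow> 'a \<Rightarrow> real. \<exists>i j. i < j \<and> j \<le> N \<and> (\<forall>f\<in>F. near_int e (s j f - s i f))"
proof -
  obtain K :: nat where K: "K > 0" "1 / real K < e"
    using \<open>e > 0\<close> by (metis nat_approx_posE zero_less_Suc)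
  define B where "B = F \<rightarrow>\<^sub>E {..<K}"
  have finB: "finite B"
    unfolding B_def using \<open>finite F\<close> by (intro finite_PiE) auto
  have "\<exists>i j. i < j \<and> j \<le> card B \<and> (\<forall>f\<in>F. near_int e (s j f - s i f))"
    for s :: "nat \<Rightarrow> 'a \<Rightarrow> real"
  proof -
    \<comment> \<open>The box of index \<open>j\<close>: for each \<open>f\<close> in
      \<open>F\<close>, the number of the interval of length \<open>1/K\<close> that contains the
      fractional part of \<open>s j f\<close>.\<close>
    define g where "g j = restrict (\<lambda>f. nat \<lfloor>frac (s j f) * K\<rfloor>) F" for j
    have "g ` {..card B} \<subseteq> B"
    proof -
      have "nat \<lfloor>frac (s j f) * K\<rfloor> < K" for j f
      proof -
        have "frac (s j f) * real K < 1 * real K"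
          using K(1) frac_lt_1[of "s j f"] by (intro mult_strict_right_mono) auto
        then show ?thesis
          using K by (simp add: floor_less_iff nat_less_iff)
      qed
      then show ?thesis
        by (auto simp: g_def B_def)
    qed
    then have "card (g ` {..card B}) < card {..card B}"
      using card_mono[OF finB, of "g ` {..card B}"] by simp
    then have "\<not> inj_on g {..card B}"
      by (rule pigeonhole)
    then obtain i j where ij: "i < j" "j \<le> card B" "g i = g j"
      unfolding inj_on_def by (metis atMost_iff linorder_neqE_nat)
    have "near_int e (s j f - s i f)" if "f \<in> F" for f
    proof -
      have "nat \<lfloor>frac (s i f) * K\<rfloor> = nat \<lfloor>frac (s j f) * K\<rfloor>"
        using fun_cong[OF ij(3), of f] that by (simp add: g_def)
      then have eq: "\<lfloor>frac (s i f) * K\<rfloor> = \<lfloor>frac (s j f) * K\<rfloor>"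
        by (simp add: eq_nat_nat_iff)
      then have "\<bar>frac (s j f) * K - frac (s i f) * K\<bar> < 1"
        by linarith
      then have "\<bar>frac (s j f) - frac (s i f)\<bar> * K < 1"
        by (simp add: left_diff_distrib[symmetric] abs_mult)
      then have "\<bar>frac (s j f) - frac (s i f)\<bar> < e"
        using K by (smt (verit) mult.commute pos_less_divide_eq of_nat_0_less_iff)
      then have "\<bar>(s j f - s i f) - of_int (\<lfloor>s j f\<rfloor> - \<lfloor>s i f\<rfloor>)\<bar> < e"
        by (simp add: frac_def algebra_simps)
      then show ?thesis
        unfolding near_int_def by blast
    qed
    then show ?thesis
      using ij by blast
  qed
  then show ?thesis
    by blast
qed

section \<open>Recurrence of real polynomials modulo 1\<close>

text \<open>Substituting \<open>x + h\<close> preserves degree and leading coefficient, so the top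
  terms cancel. The constant \<open>c\<close> affects only coefficient 0, never one above
  \<open>d\<close>; it will be \<open>f(h)\<close>, which makes the difference vanish at 0.\<close>

lemma degree_shift_diff_less:
  fixes f :: "real poly"
  assumes "degree f \<le> Suc d"
  shows "degree (pcompose f [:h, 1:] - f - [:c:]) \<le> d"
proof (rule degree_le, intro allI impI)
  fix i
  assume "d < i"
  have deg: "degree (pcompose f [:h, 1:]) = degree f"
    by (simp add: degree_pcompose)
  have "coeff (pcompose f [:h, 1:]) i = coeff f i"
  proof (cases "i = degree f")
    case True
    then show ?thesis
      using lead_coeff_comp[of "[:h, 1:]" f] deg by simp
  next
    case False
    then have "i > degree f"
      using assms \<open>d < i\<close> by linarith
    then show ?thesis
      using deg by (simp add: coeff_eq_0)
  qed
  then show "coeff (pcompose f [:h, 1:] - f - [:c:]) i = 0"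
    using \<open>d < i\<close> by (cases i) auto
qed

text \<open>The hypothesis \<open>recurrence\<close> is the induction hypothesis of the recurrence
  lemma, one degree below \<open>F\<close>. The sequence grows by one term at a time, and each
  extension spends half of the tolerance, hence the induction for arbitrary
  \<open>e\<close>.\<close>

lemma almost_additive_sequence:
  fixes F :: "real poly set"
  assumes recurrence: "\<And>G e. finite G \<Longrightarrow> (\<And>g. g \<in> G \<Longrightarrow> poly g 0 = 0 \<and> degree g \<le> d) \<Longrightarrow> e > 0 \<Longrightarrow>
      \<exists>n::int. n > 0 \<and> (\<forall>g\<in>G. near_int e (poly g (of_int n)))"
    and F: "finite F" "\<And>f. f \<in> F \<Longrightarrow> poly f 0 = 0 \<and> degree f \<le> Suc d"
    and "e > 0"
  shows "\<exists>(T :: nat \<Rightarrow> int) s. (\<forall>i j. i < j \<and> j \<le> N \<longrightarrow> T i < T j) \<and>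
      (\<forall>i j. i \<le> j \<and> j \<le> N \<longrightarrow> (\<forall>f\<in>F. near_int e (poly f (of_int (T j - T i)) - (s j f - s i f))))"
  using \<open>e > 0\<close>
proof (induction N arbitrary: e)
  case 0
  have "near_int e 0"
    using 0 unfolding near_int_def by (intro exI[of _ 0]) simp
  then show ?case
    using F by auto
next
  case (Suc N)
  obtain T :: "nat \<Rightarrow> int" and s where
    "\<forall>i j. i < j \<and> j \<le> N \<longrightarrow> T i < T j"
    "\<forall>i j. i \<le> j \<and> j \<le> N \<longrightarrow> (\<forall>f\<in>F. near_int (e/2) (poly f (of_int (T j - T i)) - (s j f - s i f)))"
    using Suc.IH[OF half_gt_zero[OF Suc.prems]] by (elim exE conjE) (rule that)
  then have
    T: "\<And>i j. i < j \<Longrightarrow> j \<le> N \<Longrightarrow> T i < T j" and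
    s: "\<And>i j f. i \<le> j \<Longrightarrow> j \<le> N \<Longrightarrow> f \<in> F \<Longrightarrow>
          near_int (e/2) (poly f (of_int (T j - T i)) - (s j f - s i f))"
    by (simp_all only: simp_thms)
  define D where "D i f = pcompose f [:of_int (T N - T i), 1:] - f - [:poly f (of_int (T N - T i)):]"
    for i and f :: "real poly"
  define G where "G = (\<lambda>(i, f). D i f) ` ({..N} \<times> F)"
  obtain n :: int where n: "n > 0" "\<And>g. g \<in> G \<Longrightarrow> near_int (e/2) (poly g (of_int n))"
  proof -
    have "finite G"
      unfolding G_def using F by auto
    moreover have "poly g 0 = 0 \<and> degree g \<le> d" if g: "g \<in> G" for g
      using g F(2) unfolding G_def D_def by (auto simp: poly_pcompose degree_shift_diff_less)
    ultimately show ?thesis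
      using recurrence[of G "e/2"] Suc.prems that by auto
  qed
  \<comment> \<open>With \<open>h = T N - T i\<close>, the value \<open>f(h + n)\<close> splits as
    \<open>D i f\<close> at \<open>n\<close> plus \<open>f(h)\<close> plus \<open>f(n)\<close>. The
    first is nearly an integer by the choice of \<open>n\<close>, the second is close to
    \<open>s N f - s i f\<close> modulo 1, and the third is absorbed into \<open>s'\<close>.\<close>
  define T' where "T' = T(Suc N := T N + n)"
  define s' where "s' = s(Suc N := (\<lambda>f. s N f + poly f (of_int n)))"
  have "T' i < T' j" if "i < j" "j \<le> Suc N" for i j
  proof (cases "j = Suc N")
    case True
    then have "T i \<le> T N"
      using T[of i N] that by (cases "i = N") auto
    then show ?thesis
      using True that n by (simp add: T'_def)
  next
    case False
    then show ?thesis
      using T that by (simp add: T'_def)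
  qed
  moreover have "near_int e (poly f (of_int (T' j - T' i)) - (s' j f - s' i f))"
    if ij: "i \<le> j" "j \<le> Suc N" and f: "f \<in> F" for i j f
  proof -
    consider "j \<le> N" | "i = j" | "j = Suc N" "i \<le> N"
      using ij by linarith
    then show ?thesis
    proof cases
      case 1
      then have "near_int (e/2) (poly f (of_int (T' j - T' i)) - (s' j f - s' i f))"
        using s ij f by (simp add: T'_def s'_def)
      then show ?thesis
        by (rule near_int_mono) (use Suc.prems in simp)
    next
      case 2
      then have "poly f (of_int (T' j - T' i)) - (s' j f - s' i f) = 0"
        using F f by simp
      then show ?thesis
        using Suc.prems unfolding near_int_def by (intro exI[of _ 0]) simp
    next
      case 3
      have "D i f \<in> G"
        unfolding G_def using 3 f by auto
      then have "near_int (e/2) (poly (D i f) (of_int n))"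
        by (rule n)
      moreover have "near_int (e/2) (poly f (of_int (T N - T i)) - (s N f - s i f))"
        using s 3 f by simp
      ultimately have "near_int (e/2 + e/2) (poly (D i f) (of_int n) + (poly f (of_int (T N - T i)) - (s N f - s i f)))"
        by (rule near_int_add)
      moreover have "poly (D i f) (of_int n) + (poly f (of_int (T N - T i)) - (s N f - s i f))
          = poly f (of_int (T' j - T' i)) - (s' j f - s' i f)"
        using 3 by (simp add: D_def T'_def s'_def poly_pcompose algebra_simps)
      ultimately show ?thesis
        by simp
    qed
  qed
  ultimately show ?case
    by blast
qed

text \<open>A whole finite family is treated because the induction step needs one \<open>n\<close>
  that serves all the shift differences simultaneously, even when it starts from a single
  polynomial.\<close>

lemma polynomial_recurrence:
  fixes F :: "real poly set"
  assumes "finite F" and "\<And>f. f \<in> F \<Longrightarrow> poly f 0 = 0 \<and> degree f \<le> d" and "e > 0"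
  shows "\<exists>n::int. n > 0 \<and> (\<forall>f\<in>F. near_int e (poly f (of_int n)))"
  using assms
proof (induction d arbitrary: F e)
  case 0
  have "poly f 1 = 0" if f: "f \<in> F" for f
    using 0(2)[OF f] by (auto elim!: degree_eq_zeroE)
  then have "near_int e (poly f (of_int 1))" if f: "f \<in> F" for f
    using f \<open>e > 0\<close> unfolding near_int_def by (intro exI[of _ 0]) simp
  then show ?case
    by (intro exI[of _ 1]) auto
next
  case (Suc d)
  obtain N where N: "\<And>s :: nat \<Rightarrow> real poly \<Rightarrow> real.
      \<exists>i j. i < j \<and> j \<le> N \<and> (\<forall>f\<in>F. near_int (e/2) (s j f - s i f))"
    using simultaneous_pigeonhole[OF \<open>finite F\<close>, of "e/2"] \<open>e > 0\<close> by auto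
  have "\<exists>(T :: nat \<Rightarrow> int) s. (\<forall>i j. i < j \<and> j \<le> N \<longrightarrow> T i < T j) \<and>
      (\<forall>i j. i \<le> j \<and> j \<le> N \<longrightarrow> (\<forall>f\<in>F. near_int (e/2) (poly f (of_int (T j - T i)) - (s j f - s i f))))"
  proof (rule almost_additive_sequence)
    show "\<exists>n::int. n > 0 \<and> (\<forall>g\<in>G. near_int \<delta> (poly g (of_int n)))"
      if "finite G" "\<And>g. g \<in> G \<Longrightarrow> poly g 0 = 0 \<and> degree g \<le> d" "\<delta> > 0" for G \<delta>
      using that by (rule Suc.IH)
  qed (use Suc.prems in auto)
  then obtain T :: "nat \<Rightarrow> int" and s where
    "\<forall>i j. i < j \<and> j \<le> N \<longrightarrow> T i < T j"
    "\<forall>i j. i \<le> j \<and> j \<le> N \<longrightarrow> (\<forall>f\<in>F. near_int (e/2) (poly f (of_int (T j - T i)) - (s j f - s i f)))"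
    by (elim exE conjE) (rule that)
  then have
    T: "\<And>i j. i < j \<Longrightarrow> j \<le> N \<Longrightarrow> T i < T j" and
    s: "\<And>i j f. i \<le> j \<Longrightarrow> j \<le> N \<Longrightarrow> f \<in> F \<Longrightarrow>
          near_int (e/2) (poly f (of_int (T j - T i)) - (s j f - s i f))"
    by (simp_all only: simp_thms)
  obtain i j where ij: "i < j" "j \<le> N" "\<And>f. f \<in> F \<Longrightarrow> near_int (e/2) (s j f - s i f)"
    using N[of s] by blast
  \<comment> \<open>One half of the error comes from almost additivity, the other from the
    pigeonhole principle.\<close>
  have "near_int e (poly f (of_int (T j - T i)))" if f: "f \<in> F" for f
    using near_int_add[OF s[of i j f] ij(3)[of f]] ij f by simp
  then show ?case
    using T[of i j] ij by (intro exI[of _ "T j - T i"]) auto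
qed

section \<open>Uniqueness of the expansion\<close>

text \<open>The \<open>c s\<close> stand for differences of digits. The top index goes first:
  multiplying by \<open>N!\<close> clears every denominator except that of the top term, which
  becomes \<open>c N / (N + 1)\<close> up to sign. As \<open>c N\<close> is at most \<open>N\<close>
  in absolute value, it vanishes, and the sum over the remaining indices is again an
  integer.\<close>

lemma negative_digits_eq_0:
  fixes c :: "nat \<Rightarrow> int"
  assumes "\<And>s. \<bar>c s\<bar> \<le> int s"
    and "(\<Sum>s=1..N. of_int (c s) * ((-1) ^ s / fact (s + 1)) :: rat) \<in> \<int>"
    and "1 \<le> s" "s \<le> N"
  shows "c s = 0"
  using assms(2-)
proof (induction N arbitrary: s)
  case 0
  then show ?case by simp
next
  case (Suc N)
  define A :: rat where "A = (\<Sum>s=1..N. of_int (c s) * ((-1) ^ s / fact (s + 1)))"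
  have A: "A + of_int (c (Suc N)) * ((-1) ^ Suc N / fact (Suc N + 1)) \<in> \<int>"
    using Suc.prems(1) by (simp add: A_def)
  have "fact (Suc N) * A \<in> \<int>"
    unfolding A_def sum_distrib_left
  proof (intro Ints_sum)
    fix i
    assume "i \<in> {1..N}"
    then have "fact (i + 1) dvd (fact (Suc N) :: int)"
      by (intro fact_dvd) auto
    then obtain z :: int where "fact (Suc N) = fact (i + 1) * z"
      by (elim dvdE)
    then have "(fact (Suc N) :: rat) = fact (i + 1) * of_int z"
      by (metis of_int_fact of_int_mult)
    then have "fact (Suc N) * (of_int (c i) * ((-1) ^ i / fact (i + 1))) = (of_int (z * c i * (-1) ^ i) :: rat)"
      by (simp del: fact_Suc)
    then show "fact (Suc N) * (of_int (c i) * ((-1) ^ i / fact (i + 1))) \<in> (\<int> :: rat set)"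
      by (metis Ints_of_int)
  qed
  moreover have "fact (Suc N) * (A + of_int (c (Suc N)) * ((-1) ^ Suc N / fact (Suc N + 1))) \<in> \<int>"
    using A Ints_mult[OF _ A, of "fact (Suc N)"] by (metis Ints_of_int of_int_fact)
  ultimately have "fact (Suc N) * (of_int (c (Suc N)) * ((-1) ^ Suc N / fact (Suc N + 1))) \<in> (\<int> :: rat set)"
    by (metis Ints_diff add_diff_cancel_left' distrib_left)
  moreover have "fact (Suc N) * (of_int (c (Suc N)) * ((-1) ^ Suc N / fact (Suc N + 1)))
      = (of_int (c (Suc N)) * (-1) ^ Suc N / of_nat (N + 2) :: rat)"
  proof -
    have "(fact (Suc N + 1) :: rat) = of_nat (N + 2) * fact (Suc N)"
      using fact_Suc[of "Suc N", where 'a = rat] by (simp del: fact_Suc)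
    then show ?thesis
      by (simp del: fact_Suc of_nat_add)
  qed
  ultimately obtain z :: int where "of_int (c (Suc N)) * (-1) ^ Suc N / of_nat (N + 2) = (of_int z :: rat)"
    by (metis Ints_cases)
  then have "of_int (c (Suc N) * (-1) ^ Suc N) = (of_int (z * int (N + 2)) :: rat)"
    by (simp add: field_simps)
  then have "c (Suc N) * (-1) ^ Suc N = z * int (N + 2)"
    by (simp only: of_int_eq_iff)
  then have "int (N + 2) dvd c (Suc N) * (-1) ^ Suc N"
    by simp
  then have "int (N + 2) dvd c (Suc N)"
    by (cases "even (Suc N)") auto
  then have c0: "c (Suc N) = 0"
    using assms(1)[of "Suc N"] zdvd_not_zless[of "\<bar>c (Suc N)\<bar>" "int (N + 2)"] by (cases "c (Suc N) = 0") auto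
  then have "A \<in> \<int>"
    using A by simp
  then show ?case
    using Suc.IH[of s] Suc.prems c0 unfolding A_def by (cases "s = Suc N") auto
qed

text \<open>Here the lowest index goes first: modulo \<open>(r + 1)!\<close> all higher terms vanish
  and the lower ones are zero by induction, so \<open>r + 1\<close> divides \<open>c r\<close>,
  which is at most \<open>r\<close> in absolute value.\<close>

lemma positive_digits_eq_0:
  fixes c :: "nat \<Rightarrow> int"
  assumes "\<And>r. \<bar>c r\<bar> \<le> int r"
    and "(\<Sum>r=1..N. c r * ((-1) ^ (r + 1) * fact r)) = 0"
    and "1 \<le> r" "r \<le> N"
  shows "c r = 0"
  using assms(3-)
proof (induction r rule: less_induct)
  case (less r)
  have "(\<Sum>i=1..N. c i * ((-1) ^ (i + 1) * fact i))
      = c r * ((-1) ^ (r + 1) * fact r) + (\<Sum>i\<in>{1..N} - {r}. c i * ((-1) ^ (i + 1) * fact i))"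
    using less.prems by (intro sum.remove) auto
  moreover have "fact (Suc r) dvd (\<Sum>i\<in>{1..N} - {r}. c i * ((-1) ^ (i + 1) * fact i))"
  proof (intro dvd_sum)
    fix i
    assume i: "i \<in> {1..N} - {r}"
    show "fact (Suc r) dvd c i * ((-1) ^ (i + 1) * fact i)"
    proof (cases "i < r")
      case True
      then show ?thesis
        using less.IH[of i] i by auto
    next
      case False
      then have "(fact (Suc r) :: int) dvd fact i"
        using i by (intro fact_dvd) auto
      then show ?thesis
        by (intro dvd_mult)
    qed
  qed
  ultimately have "fact (Suc r) dvd c r * ((-1) ^ (r + 1) * fact r)"
    using assms(2) by (simp add: dvd_add_left_iff del: fact_Suc)
  then have "int (Suc r) * fact r dvd (c r * (-1) ^ (r + 1)) * fact r"
    by (simp add: mult.assoc)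
  then have "int (Suc r) dvd c r * (-1) ^ (r + 1)"
    by (simp only: dvd_mult_cancel_right) auto
  then have "int (Suc r) dvd c r"
    by (cases "even (r + 1)") auto
  then show ?case
    using assms(1)[of r] zdvd_not_zless[of "\<bar>c r\<bar>" "int (Suc r)"] by (cases "c r = 0") auto
qed

text \<open>With one common index range, two expansions of the same number can be subtracted term by
  term; the cast exhibits the second sum as an integer.\<close>

lemma is_expansion_bounded_sum:
  assumes "is_expansion q d" and "\<And>t. d t \<noteq> 0 \<Longrightarrow> \<bar>t\<bar> \<le> int N"
  shows "q = (\<Sum>s=1..N. of_nat (d (- int s)) * ((-1) ^ s / fact (s + 1)))
           + of_int (\<Sum>r=1..N. int (d (int r)) * ((-1) ^ (r + 1) * fact r))"
proof -
  have "(\<Sum>s | 1 \<le> s \<and> d (- int s) \<noteq> 0. of_nat (d (- int s)) * ((-1) ^ s / fact (s + 1)))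
      = (\<Sum>s=1..N. of_nat (d (- int s)) * ((-1) ^ s / fact (s + 1)) :: rat)"
  proof (intro sum.mono_neutral_left)
    show "{s. 1 \<le> s \<and> d (- int s) \<noteq> 0} \<subseteq> {1..N}"
      using assms(2)[of "- int s" for s] by auto
  qed auto
  moreover have "(\<Sum>r | 1 \<le> r \<and> d (int r) \<noteq> 0. of_nat (d (int r)) * ((-1) ^ (r + 1) * fact r))
      = (\<Sum>r=1..N. of_nat (d (int r)) * ((-1) ^ (r + 1) * fact r) :: rat)"
  proof (intro sum.mono_neutral_left)
    show "{r. 1 \<le> r \<and> d (int r) \<noteq> 0} \<subseteq> {1..N}"
      using assms(2)[of "int r" for r] by auto
  qed auto
  ultimately show ?thesis
    using assms(1) by (simp add: is_expansion_def)
qed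

lemma is_expansion_digit_le:
  assumes "is_expansion q d"
  shows "d t \<le> nat \<bar>t\<bar>"
proof -
  have d: "d 0 = 0" "\<And>s. s \<ge> 1 \<Longrightarrow> d (- int s) \<le> s" "\<And>r. r \<ge> 1 \<Longrightarrow> d (int r) \<le> r"
    using assms by (simp_all only: is_expansion_def)
  consider "t = 0" | "t > 0" | "t < 0"
    by linarith
  then show ?thesis
    using d(1) d(2)[of "nat (- t)"] d(3)[of "nat t"] by cases auto
qed

text \<open>In the difference of two expansions the positive half is an integer, hence so is the
  negative half, and its digit differences vanish. The positive half is then 0, so its digit
  differences vanish as well.\<close>

lemma is_expansion_unique:
  assumes "is_expansion q d" and "is_expansion q e"
  shows "d = e"
proof -
  have fin: "finite ({t. d t \<noteq> 0} \<union> {t. e t \<noteq> 0})"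
    using assms by (simp only: is_expansion_def finite_Un)
  \<comment> \<open>Inserting 0 keeps \<open>Max\<close> meaningful when both digit functions are
    zero everywhere.\<close>
  define N where "N = nat (Max (insert 0 (abs ` ({t. d t \<noteq> 0} \<union> {t. e t \<noteq> 0}))))"
  have N: "\<bar>t\<bar> \<le> int N" if "d t \<noteq> 0 \<or> e t \<noteq> 0" for t
  proof -
    have "\<bar>t\<bar> \<le> Max (insert 0 (abs ` ({t. d t \<noteq> 0} \<union> {t. e t \<noteq> 0})))"
      using fin that by (intro Max_ge) auto
    then show ?thesis
      unfolding N_def by linarith
  qed
  define c where "c t = int (d t) - int (e t)" for t
  have c: "\<bar>c (- int s)\<bar> \<le> int s" "\<bar>c (int s)\<bar> \<le> int s" for s
    using is_expansion_digit_le[OF assms(1), of "int s"] is_expansion_digit_le[OF assms(2), of "int s"]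
      is_expansion_digit_le[OF assms(1), of "- int s"] is_expansion_digit_le[OF assms(2), of "- int s"]
    by (auto simp: c_def)
  define Z where "Z = (\<Sum>r=1..N. c (int r) * ((-1) ^ (r + 1) * fact r))"
  have difference: "S + of_int z = 0"
    if "q = a + of_int x" "q = b + of_int y" "S = a - b" "z = x - y" for a b S :: rat and x y z
    using that by simp
  have "q = (\<Sum>s=1..N. of_nat (d (- int s)) * ((-1) ^ s / fact (s + 1)))
           + of_int (\<Sum>r=1..N. int (d (int r)) * ((-1) ^ (r + 1) * fact r))"
    using assms(1) N by (intro is_expansion_bounded_sum) auto
  moreover have "q = (\<Sum>s=1..N. of_nat (e (- int s)) * ((-1) ^ s / fact (s + 1)))
           + of_int (\<Sum>r=1..N. int (e (int r)) * ((-1) ^ (r + 1) * fact r))"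
    using assms(2) N by (intro is_expansion_bounded_sum) auto
  moreover have "(\<Sum>s=1..N. of_int (c (- int s)) * ((-1) ^ s / fact (s + 1)))
      = (\<Sum>s=1..N. of_nat (d (- int s)) * ((-1) ^ s / fact (s + 1)))
        - (\<Sum>s=1..N. of_nat (e (- int s)) * ((-1) ^ s / fact (s + 1)) :: rat)"
    unfolding c_def of_int_diff of_int_of_nat_eq left_diff_distrib sum_subtractf by (rule refl)
  moreover have "Z = (\<Sum>r=1..N. int (d (int r)) * ((-1) ^ (r + 1) * fact r))
        - (\<Sum>r=1..N. int (e (int r)) * ((-1) ^ (r + 1) * fact r))"
    unfolding Z_def c_def left_diff_distrib sum_subtractf by (rule refl)
  ultimately have sum0: "(\<Sum>s=1..N. of_int (c (- int s)) * ((-1) ^ s / fact (s + 1))) + of_int Z = (0 :: rat)"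
    by (rule difference)
  then have "(\<Sum>s=1..N. of_int (c (- int s)) * ((-1) ^ s / fact (s + 1))) = (of_int (- Z) :: rat)"
    by (simp add: eq_neg_iff_add_eq_0)
  then have "(\<Sum>s=1..N. of_int (c (- int s)) * ((-1) ^ s / fact (s + 1))) \<in> (\<int> :: rat set)"
    by (metis Ints_of_int)
  then have neg: "c (- int s) = 0" if "1 \<le> s" "s \<le> N" for s
    using negative_digits_eq_0[of "\<lambda>s. c (- int s)" N s] c that by auto
  then have "Z = 0"
    using sum0 by simp
  then have pos: "c (int s) = 0" if "1 \<le> s" "s \<le> N" for s
    using positive_digits_eq_0[of "\<lambda>s. c (int s)" N s] c that by (auto simp: Z_def)
  have "d t = e t" for t
  proof (cases "d t \<noteq> 0 \<or> e t \<noteq> 0")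
    case True
    then have "\<bar>t\<bar> \<le> int N" "t \<noteq> 0"
      using N is_expansion_digit_le[OF assms(1), of t] is_expansion_digit_le[OF assms(2), of t] by auto
    then have "c t = 0"
      using pos[of "nat t"] neg[of "nat (- t)"] by (cases "t > 0") auto
    then show ?thesis
      by (simp add: c_def)
  qed auto
  then show ?thesis
    by auto
qed

section \<open>Digits of \<open>(-1)^s/(s+1)!\<close> and of multiples of \<open>r!\<close>\<close>

lemma digits_eq:
  assumes "is_expansion q d"
  shows "digits q = d"
  unfolding digits_def using assms is_expansion_unique by blast

text \<open>Source of \<open>\<beta>\<close>: arbitrarily small rationals with a single digit. That
  digit is 1, which respects the bound at index \<open>-s\<close> because \<open>s\<close> is at
  least 1.\<close>

lemma digits_power_over_fact:
  assumes "1 \<le> s"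
  shows "digits ((-1) ^ s / fact (s + 1)) = (\<lambda>t. if t = - int s then 1 else 0)"
proof (rule digits_eq)
  have "{s'. 1 \<le> s' \<and> (if - int s' = - int s then 1 else 0 :: nat) \<noteq> 0} = {s}"
    using assms by auto
  then have "(\<Sum>s' | 1 \<le> s' \<and> (if - int s' = - int s then 1 else 0 :: nat) \<noteq> 0.
      of_nat (if - int s' = - int s then 1 else 0) * ((-1) ^ s' / fact (s' + 1)))
      = ((-1) ^ s / fact (s + 1) :: rat)"
    by simp
  then show "is_expansion ((-1) ^ s / fact (s + 1)) (\<lambda>t. if t = - int s then 1 else 0)"
    using assms unfolding is_expansion_def by auto
qed

text \<open>
  Dividing with remainder by \<open>r + 1\<close> strictly decreases \<open>\<bar>m\<bar>\<close> unless \<open>\<bar>m\<bar> = 1\<close>. In that case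
  \<open>m\<close> is either a digit already or is reproduced once, facing the opposite sign: hence the
  correction term in the measure.
\<close>
lemma alternating_factorial_digits_exist:
  fixes m :: int
  assumes "1 \<le> r"
  shows "\<exists>(d :: nat \<Rightarrow> nat) N. (\<forall>i. d i \<le> i) \<and> (\<forall>i. d i \<noteq> 0 \<longrightarrow> r \<le> i \<and> i \<le> N) \<and>
      fact r * m = (\<Sum>i=1..N. int (d i) * ((-1) ^ (i + 1) * fact i))"
  using assms
proof (induction "2 * nat \<bar>m\<bar> + (if m * (-1) ^ (r + 1) < 0 then 1 else 0)" arbitrary: m r rule: less_induct)
  case less
  show ?case
  proof (cases "m = 0")
    case True
    then show ?thesis
      by (intro exI[of _ "\<lambda>_. 0"]) auto
  next
    case False
    define \<sigma> :: int where "\<sigma> = (-1) ^ (r + 1)"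
    have \<sigma>: "\<sigma> = 1 \<or> \<sigma> = -1" "(-1) ^ (Suc r + 1) = - \<sigma>"
      by (auto simp: \<sigma>_def power_add minus_one_power_iff)
    \<comment> \<open>The digit at \<open>r\<close> enters with sign \<open>\<sigma>\<close>, so
      \<open>\<sigma> * m\<close> is divided by \<open>r + 1\<close>. The remainder \<open>c\<close>
      is the digit, and \<open>r! * m = \<sigma> * c * r! + (r + 1)! * m'\<close> leaves
      \<open>m'\<close> to be expanded from index \<open>r + 1\<close> on.\<close>
    define c where "c = (\<sigma> * m) mod (int r + 1)"
    define m' where "m' = \<sigma> * ((\<sigma> * m) div (int r + 1))"
    have c: "0 \<le> c" "c \<le> int r"
      using pos_mod_bound[of "int r + 1" "\<sigma> * m"] by (auto simp: c_def)
    have m: "m = (int r + 1) * m' + \<sigma> * c"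
    proof -
      have "\<sigma> * m = (int r + 1) * ((\<sigma> * m) div (int r + 1)) + c"
        by (simp add: c_def)
      then have "\<sigma> * (\<sigma> * m) = \<sigma> * ((int r + 1) * ((\<sigma> * m) div (int r + 1)) + c)"
        by simp
      then show ?thesis
        using \<sigma>(1) by (auto simp: m'_def algebra_simps)
    qed
    have "2 * nat \<bar>m'\<bar> + (if m' * (-1) ^ (Suc r + 1) < 0 then 1 else 0)
        < 2 * nat \<bar>m\<bar> + (if m * (-1) ^ (r + 1) < 0 then 1 else 0)"
    proof -
      define M where "M = \<sigma> * m"
      define M' where "M' = M div (int r + 1)"
      have "M' \<le> M div 2" if "M > 0"
        unfolding M'_def using that less.prems by (intro zdiv_mono2) auto
      moreover have "M div 1 \<le> M'" if "M < 0"
        unfolding M'_def using that by (intro zdiv_mono2_neg) auto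
      moreover have "M' < 0" if "M < 0"
        unfolding M'_def using that by (intro div_neg_pos_less0) auto
      moreover have "M \<noteq> 0" "\<bar>M\<bar> = \<bar>m\<bar>" "\<bar>M'\<bar> = \<bar>m'\<bar>"
        using \<sigma>(1) False by (auto simp: M_def M'_def m'_def)
      moreover have "m * (-1) ^ (r + 1) = M"
        unfolding M_def \<sigma>_def by (rule mult.commute)
      moreover have "m' * (-1) ^ (Suc r + 1) = - M'"
        unfolding \<sigma>(2) m'_def M'_def M_def using \<sigma>(1) by auto
      \<comment> \<open>For \<open>M > 0\<close> the quotient is at most \<open>M/2\<close>, since
        \<open>r + 1\<close> is at least 2. For \<open>M < 0\<close> it lies between
        \<open>M\<close> and -1: its absolute value need not drop, but the correction term falls
        from 1 to 0.\<close>
      moreover have "2 * nat \<bar>M'\<bar> + (if - M' < 0 then 1 else 0) < 2 * nat \<bar>M\<bar> + (if M < 0 then 1 else 0)"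
      proof (cases "M > 0")
        case True
        then have "0 \<le> M'"
          unfolding M'_def by (simp add: pos_imp_zdiv_nonneg_iff)
        then show ?thesis
          using True \<open>0 < M \<Longrightarrow> M' \<le> M div 2\<close> by (cases "M' = 0") auto
      next
        case False
        then have "M \<le> M'" "M' < 0"
          using \<open>M < 0 \<Longrightarrow> M div 1 \<le> M'\<close> \<open>M < 0 \<Longrightarrow> M' < 0\<close> \<open>M \<noteq> 0\<close> by auto
        then show ?thesis
          by simp
      qed
      ultimately show ?thesis
        by (simp only:)
    qed
    then obtain d N where d: "\<And>i. d i \<le> i" "\<And>i. d i \<noteq> 0 \<Longrightarrow> Suc r \<le> i \<and> i \<le> N"
      "fact (Suc r) * m' = (\<Sum>i=1..N. int (d i) * ((-1) ^ (i + 1) * fact i))"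
      using less.hyps[of m' "Suc r"] by auto
    define d' where "d' = d(r := nat c)"
    \<comment> \<open>\<open>N\<close> may lie below \<open>r\<close> when \<open>d\<close> is zero
      everywhere.\<close>
    define N' where "N' = max N r"
    have "d' i \<le> i" for i
      using d c by (auto simp: d'_def)
    moreover have "r \<le> i \<and> i \<le> N'" if "d' i \<noteq> 0" for i
      using d(2)[of i] that by (auto simp: d'_def N'_def split: if_splits)
    moreover have "fact r * m = (\<Sum>i=1..N'. int (d' i) * ((-1) ^ (i + 1) * fact i))"
    proof -
      have "(\<Sum>i=1..N'. int (d' i) * ((-1) ^ (i + 1) * fact i))
          = int (d' r) * ((-1) ^ (r + 1) * fact r) + (\<Sum>i\<in>{1..N'} - {r}. int (d' i) * ((-1) ^ (i + 1) * fact i))"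
        using less.prems by (intro sum.remove) (auto simp: N'_def)
      also have "(\<Sum>i\<in>{1..N'} - {r}. int (d' i) * ((-1) ^ (i + 1) * fact i))
          = (\<Sum>i\<in>{1..N'} - {r}. int (d i) * ((-1) ^ (i + 1) * fact i))"
        by (intro sum.cong) (auto simp: d'_def)
      \<comment> \<open>The digits of \<open>d\<close> start at \<open>r + 1\<close>, so index
        \<open>r\<close> can be put back.\<close>
      also have "\<dots> = (\<Sum>i=1..N'. int (d i) * ((-1) ^ (i + 1) * fact i))"
        using d(2)[of r] by (intro sum.mono_neutral_left) auto
      also have "\<dots> = (\<Sum>i=1..N. int (d i) * ((-1) ^ (i + 1) * fact i))"
      proof (intro sum.mono_neutral_right)
        have "d i = 0" if "\<not> i \<le> N" for i
          using d(2)[of i] that by (cases "d i = 0") auto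
        then show "\<forall>i\<in>{1..N'} - {1..N}. int (d i) * ((-1) ^ (i + 1) * fact i) = 0"
          by auto
      qed (auto simp: N'_def)
      also have "\<dots> = fact (Suc r) * m'"
        using d(3) by simp
      also have "int (d' r) * ((-1) ^ (r + 1) * fact r) + fact (Suc r) * m' = fact r * ((int r + 1) * m' + \<sigma> * c)"
        unfolding \<sigma>_def[symmetric] using c by (simp add: d'_def algebra_simps)
      finally show ?thesis
        using m by simp
    qed
    ultimately show ?thesis
      by blast
  qed
qed

text \<open>Source of \<open>\<gamma>\<close>: finiteness and nonemptiness ensure that the least
  index with a nonzero digit exists, and the first claim bounds it below by
  \<open>r\<close>.\<close>

lemma digits_multiple_of_fact:
  fixes m :: int
  assumes "1 \<le> r"
  shows "digits (of_int (fact r * m)) t \<noteq> 0 \<Longrightarrow> int r \<le> t"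
    and "finite {t. digits (of_int (fact r * m)) t \<noteq> 0}"
    and "m \<noteq> 0 \<Longrightarrow> \<exists>t. digits (of_int (fact r * m)) t \<noteq> 0"
proof -
  obtain d N where d: "\<And>i. d i \<le> i" "\<And>i. d i \<noteq> 0 \<Longrightarrow> r \<le> i \<and> i \<le> N"
    and sum: "fact r * m = (\<Sum>i=1..N. int (d i) * ((-1) ^ (i + 1) * fact i))"
    using alternating_factorial_digits_exist[OF assms, of m] by blast
  define e where "e t = (if t > 0 then d (nat t) else 0)" for t :: int
  have e: "int r \<le> t \<and> t \<le> int N" if "e t \<noteq> 0" for t
    using d(2)[of "nat t"] that by (auto simp: e_def split: if_splits)
  have fin: "finite {t. e t \<noteq> 0}"
    by (rule finite_subset[of _ "{int r..int N}"]) (use e in auto)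
  have "of_int (fact r * m) = (\<Sum>i=1..N. of_nat (d i) * ((-1) ^ (i + 1) * fact i) :: rat)"
    unfolding sum by simp
  also have "\<dots> = (\<Sum>i | 1 \<le> i \<and> e (int i) \<noteq> 0. of_nat (e (int i)) * ((-1) ^ (i + 1) * fact i))"
    using d(2) by (intro sum.mono_neutral_cong_right) (auto simp: e_def)
  finally have "is_expansion (of_int (fact r * m)) e"
    unfolding is_expansion_def using d(1) fin by (auto simp: e_def)
  then have eq: "digits (of_int (fact r * m)) = e"
    by (rule digits_eq)
  show "digits (of_int (fact r * m)) t \<noteq> 0 \<Longrightarrow> int r \<le> t"
    unfolding eq using e by blast
  show "finite {t. digits (of_int (fact r * m)) t \<noteq> 0}"
    unfolding eq by (rule fin)
  show "\<exists>t. digits (of_int (fact r * m)) t \<noteq> 0" if "m \<noteq> 0"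
  proof (rule ccontr)
    assume "\<not> ?thesis"
    then have "e (int i) = 0" for i
      unfolding eq by blast
    then have "d i = 0" if "i \<in> {1..N}" for i
      using that by (metis atLeastAtMost_iff e_def less_le_trans nat_int of_nat_0_less_iff zero_less_one)
    then show False
      using sum \<open>m \<noteq> 0\<close> by simp
  qed
qed

section \<open>Construction of \<open>\<gamma>\<close> and \<open>\<beta>\<close>\<close>

theorem mainTheorem14:
  fixes P :: "real poly" and k :: nat and k1 k2 \<epsilon> :: real
  assumes "poly P 0 = 0" and "k \<ge> 1" and "k1 < k2" and "\<epsilon> > 0"
  shows "\<exists>(\<beta> :: rat) (\<gamma> :: int) (m :: nat \<Rightarrow> nat \<Rightarrow> int).
           \<beta> \<notin> \<int> \<and> \<gamma> \<noteq> 0 \<and>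
           dom_pos \<beta> = {} \<and> dom_neg (of_int \<gamma>) = {} \<and>
           real_of_int (Max (dom_neg \<beta>)) < k1 \<and> k2 < real_of_int (Min (dom_pos (of_int \<gamma>))) \<and>
           (\<forall>p\<le>k. \<forall>q\<le>k.
              \<bar>poly P (of_nat p * of_rat \<beta> + of_nat q * of_int \<gamma>) - of_int (m p q)\<bar> < \<epsilon>)"
proof -
  obtain r :: nat where r: "1 \<le> r" "k2 < real r"
  proof -
    obtain r :: nat where "max 1 k2 < real r"
      using reals_Archimedean2 by blast
    then show ?thesis
      using that[of r] by auto
  qed
  \<comment> \<open>The factor \<open>r!\<close> is built into the polynomials, so a recurrence time
    \<open>n\<close> of this family yields \<open>\<gamma> = r! * n\<close> for all
    \<open>q \<le> k\<close> at once. For \<open>q = 0\<close> the composition is the zero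
    polynomial.\<close>
  define F where "F = (\<lambda>q. pcompose P [:0, of_nat q * fact r:]) ` {..k}"
  have "\<exists>n::int. n > 0 \<and> (\<forall>f\<in>F. near_int (\<epsilon>/2) (poly f (of_int n)))"
  proof (rule polynomial_recurrence)
    show "poly f 0 = 0 \<and> degree f \<le> degree P" if "f \<in> F" for f
      using that assms(1) by (auto simp: F_def poly_pcompose degree_pcompose)
  qed (use \<open>\<epsilon> > 0\<close> in \<open>auto simp: F_def\<close>)
  then obtain n :: int where n: "n > 0" "\<And>f. f \<in> F \<Longrightarrow> near_int (\<epsilon>/2) (poly f (of_int n))"
    by blast
  define \<gamma> :: int where "\<gamma> = fact r * n"
  have near: "near_int (\<epsilon>/2) (poly P (of_nat q * of_int \<gamma>))" if "q \<le> k" for q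
    using n(2)[of "pcompose P [:0, of_nat q * fact r:]"] that
    by (simp add: F_def \<gamma>_def poly_pcompose mult_ac)
  \<comment> \<open>The nearby integer depends on \<open>q\<close> alone: adding \<open>p\<close>
    times a small \<open>\<beta>\<close> will cost only the other half of
    \<open>\<epsilon>\<close>.\<close>
  then obtain \<mu> :: "nat \<Rightarrow> int" where \<mu>: "\<And>q. q \<le> k \<Longrightarrow> \<bar>poly P (of_nat q * of_int \<gamma>) - of_int (\<mu> q)\<bar> < \<epsilon>/2"
    unfolding near_int_def by metis

  have \<gamma>: "\<gamma> \<noteq> 0" "dom_neg (of_int \<gamma>) = {}" "k2 < real_of_int (Min (dom_pos (of_int \<gamma>)))"
  proof -
    show "\<gamma> \<noteq> 0"
      using n by (simp add: \<gamma>_def)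
    have ge: "int r \<le> t" if "digits (of_int \<gamma>) t \<noteq> 0" for t
      using digits_multiple_of_fact(1)[OF r(1)] that unfolding \<gamma>_def by blast
    show "dom_neg (of_int \<gamma>) = {}"
    proof -
      have "\<not> t < 0" if "digits (of_int \<gamma>) t \<noteq> 0" for t
        using ge[OF that] by linarith
      then show ?thesis
        unfolding dom_neg_def expansion_dom_def by blast
    qed
    have "finite (dom_pos (of_int \<gamma>))"
      using digits_multiple_of_fact(2)[OF r(1), of n]
      by (rule rev_finite_subset) (auto simp: dom_pos_def expansion_dom_def \<gamma>_def)
    moreover have "dom_pos (of_int \<gamma>) \<noteq> {}"
    proof -
      obtain t where t: "digits (of_int \<gamma>) t \<noteq> 0"
        using digits_multiple_of_fact(3)[OF r(1), of n] n(1) unfolding \<gamma>_def by auto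
      then have "t > 0"
        using ge[OF t] r(1) by linarith
      then have "t \<in> dom_pos (of_int \<gamma>)"
        using t by (simp add: dom_pos_def expansion_dom_def)
      then show ?thesis
        by blast
    qed
    ultimately have "Min (dom_pos (of_int \<gamma>)) \<in> dom_pos (of_int \<gamma>)"
      by (rule Min_in)
    then have "int r \<le> Min (dom_pos (of_int \<gamma>))"
      using ge by (simp add: dom_pos_def expansion_dom_def)
    then show "k2 < real_of_int (Min (dom_pos (of_int \<gamma>)))"
      using r(2) by linarith
  qed

  \<comment> \<open>These are the terms of the exponential series at 1, shifted by one
    index.\<close>
  have "(\<lambda>s. inverse (fact (s + 1)) :: real) \<longlonglongrightarrow> 0"
    using LIMSEQ_Suc[OF summable_LIMSEQ_zero[OF summable_exp[of "1::real"]]] by simp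
  then have lim: "(\<lambda>s. (-1) ^ s / fact (s + 1) :: real) \<longlonglongrightarrow> 0"
    by (subst tendsto_rabs_zero_iff[symmetric]) (simp add: abs_mult power_abs divide_inverse del: fact_Suc)
  \<comment> \<open>Since \<open>\<gamma>\<close> is already fixed, continuity of \<open>P\<close>
    is used at finitely many points only, which gives one threshold for \<open>s\<close>.\<close>
  have "\<forall>\<^sub>F s in sequentially. \<forall>p\<in>{..k}. \<forall>q\<in>{..k}.
      \<bar>poly P (of_nat p * ((-1) ^ s / fact (s + 1)) + of_nat q * of_int \<gamma>) - poly P (of_nat q * of_int \<gamma>)\<bar> < \<epsilon>/2"
  proof (intro eventually_ball_finite ballI finite_atMost)
    fix p q
    have "(\<lambda>s. of_nat p * ((-1) ^ s / fact (s + 1)) + of_nat q * of_int \<gamma> :: real)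
        \<longlonglongrightarrow> of_nat p * 0 + of_nat q * of_int \<gamma>"
      by (intro tendsto_intros lim)
    then have "(\<lambda>s. poly P (of_nat p * ((-1) ^ s / fact (s + 1)) + of_nat q * of_int \<gamma>))
        \<longlonglongrightarrow> poly P (of_nat q * of_int \<gamma>)"
      by (intro tendsto_poly) simp
    then show "\<forall>\<^sub>F s in sequentially.
        \<bar>poly P (of_nat p * ((-1) ^ s / fact (s + 1)) + of_nat q * of_int \<gamma>) - poly P (of_nat q * of_int \<gamma>)\<bar> < \<epsilon>/2"
      using \<open>\<epsilon> > 0\<close> by (auto dest!: tendstoD[of _ _ _ "\<epsilon>/2"] simp: dist_real_def)
  qed
  \<comment> \<open>This becomes \<open>-s < k1\<close>, where \<open>-s\<close> is the only element
    of the negative domain of \<open>\<beta>\<close> and hence its maximum.\<close>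
  moreover have "\<forall>\<^sub>F s in sequentially. - k1 < real s"
    using filterlim_real_sequentially by (simp add: filterlim_at_top_dense)
  ultimately have "\<forall>\<^sub>F s in sequentially. 1 \<le> s \<and> - k1 < real s \<and> (\<forall>p\<in>{..k}. \<forall>q\<in>{..k}.
      \<bar>poly P (of_nat p * ((-1) ^ s / fact (s + 1)) + of_nat q * of_int \<gamma>) - poly P (of_nat q * of_int \<gamma>)\<bar> < \<epsilon>/2)"
    using eventually_ge_at_top[of 1] by eventually_elim simp
  then obtain s where s: "1 \<le> s" "- k1 < real s"
    and close: "\<And>p q. p \<le> k \<Longrightarrow> q \<le> k \<Longrightarrow>
      \<bar>poly P (of_nat p * ((-1) ^ s / fact (s + 1)) + of_nat q * of_int \<gamma>) - poly P (of_nat q * of_int \<gamma>)\<bar> < \<epsilon>/2"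
    by (auto dest: eventually_happens)
  define \<beta> :: rat where "\<beta> = (-1) ^ s / fact (s + 1)"
  have \<beta>_real: "(of_rat \<beta> :: real) = (-1) ^ s / fact (s + 1)"
  proof -
    have "(of_rat (fact (s + 1)) :: real) = fact (s + 1)"
      by (metis of_nat_fact of_rat_of_nat_eq)
    then show ?thesis
      by (simp add: \<beta>_def of_rat_divide of_rat_power of_rat_minus del: fact_Suc)
  qed
  have "dom_pos \<beta> = {}" "dom_neg \<beta> = {- int s}"
    using s(1) digits_power_over_fact[OF s(1)] unfolding \<beta>_def dom_pos_def dom_neg_def expansion_dom_def
    by auto
  moreover have "\<beta> \<notin> \<int>"
  proof
    assume "\<beta> \<in> \<int>"
    then obtain z where "\<beta> = of_int z"
      by (rule Ints_cases)
    \<comment> \<open>As \<open>s\<close> is at least 1, \<open>(s + 1)!\<close> exceeds 1, and no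
      integer has absolute value strictly between 0 and 1.\<close>
    moreover have "\<bar>\<beta>\<bar> > 0" "\<bar>\<beta>\<bar> < 1"
    proof -
      have "(fact 1 :: rat) < fact (s + 1)"
        using s(1) by (intro fact_less_mono) auto
      then show "\<bar>\<beta>\<bar> < 1" "\<bar>\<beta>\<bar> > 0"
        by (simp_all add: \<beta>_def power_abs del: fact_Suc)
    qed
    ultimately show False
      by (simp flip: of_int_abs)
  qed
  moreover have "\<bar>poly P (of_nat p * of_rat \<beta> + of_nat q * of_int \<gamma>) - of_int (\<mu> q)\<bar> < \<epsilon>"
    if "p \<le> k" "q \<le> k" for p q
    using close[OF that] \<mu>[OF that(2)] unfolding \<beta>_real by linarith
  ultimately show ?thesis
    using \<gamma> s(2) by (intro exI[of _ \<beta>] exI[of _ \<gamma>] exI[of _ "\<lambda>_. \<mu>"]) auto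
qed

end
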